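(* For $i\in\{1,2\}$ let $\bar R_i:=\sup_{(\xi,a)\in\Sigma_i}U_i(\xi,a)\in\,]-\infty,+\infty]$. Suppose that for every real $R\le\min\{\bar R_1,\bar R_2\}$ and every $i\in\{1,2\}$ we have $S(X_i,u_i,c_i,R)\neq\emptyset$. Suppose moreover that there exists a real $R_0\le\min\{\bar R_1,\bar R_2\}$ such that one of the following assertions holds: (i) there exists $i\in\{1,2\}$ such that $\gamma_i=1$ and $V(X_i,u_i,c_i,R_0)>0\ge V(X_{-i},u_{-i},c_{-i},R_0)$; (ii) there exists $i\in\{1,2\}$ such that $\gamma_i=1$ and $V(X_i,u_i,c_i,R_0)\ge 0> V(X_{-i},u_{-i},c_{-i},R_0)$; (iii) $V(X_1,u_1,c_1,R_0)=V(X_2,u_2,c_2,R_0)=0$. Then there exists a Nash equilibrium $(\xi_1,a_1)\in\Sigma_1$, $(\xi_2,a_2)\in\Sigma_2$ of the PPA game such that, for every $i\in\{1,2\}$, $$V(X_i,u_i,c_i,R_0)\ge 0\ \Longrightarrow\ (\xi_i,a_i)\in S(X_i,u_i,c_i,R_0).$$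
   Context: Setting. $(\Omega,\mathcal F,\mathbb P)$ is a probability space carrying two independent real random variables $X_1,X_2$. For $i\in\{1,2\}$, $-i$ denotes the other index. For each $i$: $A_i\subset\mathbb R$ is a nonempty compact set; for each $a\in A_i$, $\mathbb P_i^a$ is a probability measure (absolutely continuous with respect to $\mathbb P$) describing the distribution of $X_i$ under effort $a$, with expectation $\mathbb E_i^a$; $u_i:\mathbb R\to\mathbb R$ is strictly increasing, concave and differentiable; $c_i:A_i\to\mathbb R$ is increasing and convex; $\Xi_i$ is a set of real $\sigma(X_i)$-measurable random variables (contracts), with $0\in\Xi_1\cap\Xi_2$. Upper-gap: for $\xi\in\Xi_i$, $\alpha_i(\xi):=\sup\{\delta\in\mathbb R: u_i(\xi)+\delta\le \sup u_i(\mathbb R)\ \mathbb P\text{-a.s.}\}\in[0,+\infty]$. Admissibility of $\Xi_i$: for all $\xi\in\Xi_i$ and $a\in A_i$, the variables $X_i,\xi,u_i(\xi)$ are $\mathbb P_i^a$-integrable; and for every $\xi\in\Xi_i$ and every real $\delta<\alpha_i(\xi)$, the perturbed contract $u_i^{-1}(u_i(\xi)+\delta)$ belongs to $\Xi_i$. Define $U_i(\xi,a):=\mathbb E_i^a[u_i(\xi)-c_i(a)]$ and $\Sigma_i:=\{(\xi,a)\in\Xi_i\times A_i: a\in\operatorname{arg\,max}_{b\in A_i}U_i(\xi,b)\}$. Partition: $C_i^0,C_i^i,C_i^{-i}$ are the sets of $(\xi_i,a_i,\xi_{-i},a_{-i})\in\Sigma_i\times\Sigma_{-i}$ with respectively $U_i(\xi_i,a_i)=U_{-i}(\xi_{-i},a_{-i})$,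 $U_i(\xi_i,a_i)>U_{-i}(\xi_{-i},a_{-i})$, $U_i(\xi_i,a_i)<U_{-i}(\xi_{-i},a_{-i})$. PPA game: fixed biases $\gamma_1,\gamma_2\in[0,1]$ with $\gamma_1+\gamma_2=1$. Principal $i$ chooses $(\xi_i,a_i)\in\Sigma_i$; her payoff $J_i(X_i,(\xi_i,a_i),(\xi_{-i},a_{-i}),\gamma_i)$ equals $\mathbb E_i^{a_i}[X_i-\xi_i]$ on $C_i^i$, $\gamma_i\mathbb E_i^{a_i}[X_i-\xi_i]$ on $C_i^0$, and $0$ on $C_i^{-i}$. $BR_i(\xi_{-i},a_{-i})\subset\Sigma_i$ is the (possibly empty) set of maximizers of $J_i(X_i,\cdot,(\xi_{-i},a_{-i}),\gamma_i)$ over $\Sigma_i$. A Nash equilibrium is a pair $(\xi_1,a_1)\in\Sigma_1$, $(\xi_2,a_2)\in\Sigma_2$ with $(\xi_1,a_1)\in BR_1(\xi_2,a_2)$ and $(\xi_2,a_2)\in BR_2(\xi_1,a_1)$. Individual problem: for $R\in\mathbb R$, $V(X_i,u_i,c_i,R):=\sup\{\mathbb E_i^a[X_i-\xi]:(\xi,a)\in\Sigma_i,\ U_i(\xi,a)\ge R\}$ (with $\sup\emptyset=-\infty$), and $S(X_i,u_i,c_i,R)$ is the set of pairs attaining this supremum. *)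

theory Defs
  imports "HOL-Probability.Probability"
begin

datatype player = P1 | P2

fun other :: "player \<Rightarrow> player" where
  "other P1 = P2"
| "other P2 = P1"

text \<open>
  \<open>law G i a\<close> is the measure $P_i^a$ on the whole sample space; \<open>cost G i\<close> and \<open>law G i\<close> are
  only meaningful on \<open>efforts G i\<close>.
\<close>

record 'a ppa =
  base :: "'a measure"
  outcome :: "player \<Rightarrow> 'a \<Rightarrow> real"
  efforts :: "player \<Rightarrow> real set"
  law :: "player \<Rightarrow> real \<Rightarrow> 'a measure"
  utility :: "player \<Rightarrow> real \<Rightarrow> real"
  cost :: "player \<Rightarrow> real \<Rightarrow> real"
  contracts :: "player \<Rightarrow> ('a \<Rightarrow> real) set"
  bias :: "player \<Rightarrow> real"

type_synonym 'a offer = "('a \<Rightarrow> real) \<times> real"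

definition upper_gap :: "'a ppa \<Rightarrow> player \<Rightarrow> ('a \<Rightarrow> real) \<Rightarrow> ereal" where
  "upper_gap G i \<xi> =
     Sup (ereal ` {\<delta>. AE \<omega> in base G. ereal (utility G i (\<xi> \<omega>) + \<delta>) \<le> (SUP x. ereal (utility G i x))})"

text \<open>
  Contracts are random variables and are identified when they agree almost surely: for
  \<open>\<delta>\<close> below the upper gap, \<open>u (\<xi> \<omega>) + \<delta>\<close> lies in the range of \<open>u\<close> only for almost every \<open>\<omega>\<close>,
  so admissibility asks for some version of the perturbed contract to be in the contract set.
\<close>

definition admissible :: "'a ppa \<Rightarrow> player \<Rightarrow> bool" where
  "admissible G i \<longleftrightarrow>
     (\<forall>\<xi>\<in>contracts G i. \<forall>a\<in>efforts G i.
        integrable (law G i a) (outcome G i) \<and>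
        integrable (law G i a) \<xi> \<and>
        integrable (law G i a) (\<lambda>\<omega>. utility G i (\<xi> \<omega>))) \<and>
     (\<forall>\<xi>\<in>contracts G i. \<forall>\<delta>::real. ereal \<delta> < upper_gap G i \<xi> \<longrightarrow>
        (\<exists>\<zeta>\<in>contracts G i. AE \<omega> in base G. \<zeta> \<omega> = inv (utility G i) (utility G i (\<xi> \<omega>) + \<delta>)))"

text \<open>
  The effort sets need not be intervals, whereas \<^const>\<open>convex_on\<close> requires a convex domain; hence
  convexity of the cost is spelled out on those convex combinations that are feasible efforts.
\<close>

locale ppa_game = prob_space "base G" for G :: "'a ppa" +
  assumes outcome_rv: "\<And>i. outcome G i \<in> borel_measurable (base G)"
    and outcome_indep: "indep_var borel (outcome G P1) borel (outcome G P2)"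
    and efforts_nonempty: "\<And>i. efforts G i \<noteq> {}"
    and efforts_compact: "\<And>i. compact (efforts G i)"
    and law_prob: "\<And>i a. a \<in> efforts G i \<Longrightarrow> prob_space (law G i a)"
    and law_sets: "\<And>i a. a \<in> efforts G i \<Longrightarrow> sets (law G i a) = sets (base G)"
    and law_ac: "\<And>i a. a \<in> efforts G i \<Longrightarrow> absolutely_continuous (base G) (law G i a)"
    and utility_strict_mono: "\<And>i. strict_mono (utility G i)"
    and utility_concave: "\<And>i. concave_on UNIV (utility G i)"
    and utility_differentiable: "\<And>i. utility G i differentiable_on UNIV"
    and cost_mono: "\<And>i. mono_on (efforts G i) (cost G i)"
    and cost_convex: "\<And>i a b t. a \<in> efforts G i \<Longrightarrow> b \<in> efforts G i \<Longrightarrow> 0 \<le> t \<Longrightarrow> t \<le> 1 \<Longrightarrow>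
          (1 - t) * a + t * b \<in> efforts G i \<Longrightarrow>
          cost G i ((1 - t) * a + t * b) \<le> (1 - t) * cost G i a + t * cost G i b"
    and contracts_measurable: "\<And>i \<xi>. \<xi> \<in> contracts G i \<Longrightarrow>
          \<xi> \<in> borel_measurable (vimage_algebra (space (base G)) (outcome G i) borel)"
    and zero_contract: "\<And>i. (\<lambda>_. 0) \<in> contracts G i"
    and contracts_admissible: "\<And>i. admissible G i"
    and bias_range: "\<And>i. bias G i \<in> {0..1}"
    and bias_sum: "bias G P1 + bias G P2 = 1"

definition agent_utility :: "'a ppa \<Rightarrow> player \<Rightarrow> 'a offer \<Rightarrow> real" where
  "agent_utility G i = (\<lambda>(\<xi>, a). \<integral>\<omega>. (utility G i (\<xi> \<omega>) - cost G i a) \<partial>law G i a)"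

definition principal_profit :: "'a ppa \<Rightarrow> player \<Rightarrow> 'a offer \<Rightarrow> real" where
  "principal_profit G i = (\<lambda>(\<xi>, a). \<integral>\<omega>. (outcome G i \<omega> - \<xi> \<omega>) \<partial>law G i a)"

text \<open>The strategy sets $\Sigma_i$ of incentive compatible offers.\<close>

definition offers :: "'a ppa \<Rightarrow> player \<Rightarrow> 'a offer set" where
  "offers G i = {(\<xi>, a). \<xi> \<in> contracts G i \<and> a \<in> efforts G i \<and>
     is_arg_max (\<lambda>b. agent_utility G i (\<xi>, b)) (\<lambda>b. b \<in> efforts G i) a}"

definition C_tie :: "'a ppa \<Rightarrow> player \<Rightarrow> ('a offer \<times> 'a offer) set" where
  "C_tie G i = {(p, q) \<in> offers G i \<times> offers G (other i).
     agent_utility G i p = agent_utility G (other i) q}"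

definition C_win :: "'a ppa \<Rightarrow> player \<Rightarrow> ('a offer \<times> 'a offer) set" where
  "C_win G i = {(p, q) \<in> offers G i \<times> offers G (other i).
     agent_utility G i p > agent_utility G (other i) q}"

definition C_lose :: "'a ppa \<Rightarrow> player \<Rightarrow> ('a offer \<times> 'a offer) set" where
  "C_lose G i = {(p, q) \<in> offers G i \<times> offers G (other i).
     agent_utility G i p < agent_utility G (other i) q}"

text \<open>Only evaluated on pairs of offers, where the final \<open>undefined\<close> is never reached.\<close>

definition payoff :: "'a ppa \<Rightarrow> player \<Rightarrow> 'a offer \<Rightarrow> 'a offer \<Rightarrow> real" where
  "payoff G i p q =
     (if (p, q) \<in> C_win G i then principal_profit G i p
      else if (p, q) \<in> C_tie G i then bias G i * principal_profit G i p
      else if (p, q) \<in> C_lose G i then 0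
      else undefined)"

definition best_responses :: "'a ppa \<Rightarrow> player \<Rightarrow> 'a offer \<Rightarrow> 'a offer set" where
  "best_responses G i q = {p. is_arg_max (\<lambda>p. payoff G i p q) (\<lambda>p. p \<in> offers G i) p}"

definition nash_equilibrium :: "'a ppa \<Rightarrow> (player \<Rightarrow> 'a offer) \<Rightarrow> bool" where
  "nash_equilibrium G p \<longleftrightarrow>
     (\<forall>i. p i \<in> offers G i \<and> p i \<in> best_responses G i (p (other i)))"

definition feasible :: "'a ppa \<Rightarrow> player \<Rightarrow> real \<Rightarrow> 'a offer set" where
  "feasible G i R = {p \<in> offers G i. agent_utility G i p \<ge> R}"

definition V :: "'a ppa \<Rightarrow> player \<Rightarrow> real \<Rightarrow> ereal" where
  "V G i R = (SUP p\<in>feasible G i R. ereal (principal_profit G i p))"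

definition S :: "'a ppa \<Rightarrow> player \<Rightarrow> real \<Rightarrow> 'a offer set" where
  "S G i R = {p \<in> feasible G i R. ereal (principal_profit G i p) = V G i R}"

definition R_bar :: "'a ppa \<Rightarrow> player \<Rightarrow> ereal" where
  "R_bar G i = (SUP p\<in>offers G i. ereal (agent_utility G i p))"

end

theory Submission
  imports Defs
begin

text \<open>
  Both principals offer a solution of their individual problem with reservation utility \<open>R\<^sub>0\<close>,
  and this pair is already an equilibrium.

  The essential point is that the participation constraint binds at every such solution
  (\<open>optimal_offer_binds\<close>). A strictly increasing concave utility is unbounded below, so an offer
  leaving its agent strictly more than \<open>R\<^sub>0\<close> can be made less generous by lowering the agent's
  utility by the same constant in every state. The shift does not affect the agent's comparison of
  efforts, hence the offer stays incentive compatible, while the wage falls almost surely, so the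
  principal strictly gains (\<open>cheaper_offer\<close>).

  Consequently the two optimal offers tie at the level \<open>R\<^sub>0\<close>, and each principal gets her bias
  times her optimal profit \<open>V G i R\<^sub>0\<close>. Against an offer worth \<open>R\<^sub>0\<close> to the rival's agent, a deviation
  either loses and earns \<open>0\<close>, or is feasible for the individual problem and earns at most
  \<open>max 0 (V G i R\<^sub>0)\<close> (\<open>payoff_le_max\<close>). The three alternatives of the theorem all say that the tie
  payoff already equals \<open>max 0 (V G i R\<^sub>0)\<close>: a principal with positive value has full bias, and
  one with negative value has bias \<open>0\<close>.
\<close>

text \<open>
  By concavity the function lies, to the left of \<open>0\<close>, below the line through its
  values at \<open>0\<close> and \<open>1\<close>, which has positive slope; it is therefore unbounded below, and the intermediate value theorem
  reaches every level under an attained one.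
\<close>

lemma range_downward_closed_concave_strict_mono:
  fixes f :: "real \<Rightarrow> real"
  assumes mono: "strict_mono f" and concave: "concave_on UNIV f"
    and cont: "continuous_on UNIV f" and below: "y \<le> f x"
  shows "y \<in> range f"
proof -
  define s where "s = f 1 - f 0"
  have s: "s > 0"
    using mono unfolding s_def by (simp add: strict_monoD)
  have chord: "f (-t) \<le> f 0 - t * s" if t: "t \<ge> 0" for t
  proof -
    have conv: "convex_on UNIV (\<lambda>x. - f x)"
      using concave by (simp add: concave_on_def)
    \<comment> \<open>The point \<open>0\<close> divides the segment from \<open>-t\<close> to \<open>1\<close> in the ratio \<open>t : 1\<close>.\<close>
    have "- f ((1 - t / (1 + t)) *\<^sub>R (-t) + (t / (1 + t)) *\<^sub>R 1)
        \<le> (1 - t / (1 + t)) * (- f (-t)) + (t / (1 + t)) * (- f 1)"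
      by (rule convex_onD[OF conv]) (use t in auto)
    moreover have "(1 - t / (1 + t)) *\<^sub>R (-t) + (t / (1 + t)) *\<^sub>R 1 = 0"
      using t by (simp add: field_simps)
    moreover have "1 - t / (1 + t) = 1 / (1 + t)"
      using t by (simp add: field_simps)
    ultimately have "(f (-t) + t * f 1) / (1 + t) \<le> f 0"
      by (simp add: add_divide_distrib)
    then show ?thesis
      using t by (simp add: s_def pos_divide_le_eq algebra_simps)
  qed
  define t where "t = max (max 0 (- x)) ((f 0 - y) / s)"
  have "(f 0 - y) / s \<le> t"
    unfolding t_def by simp
  then have "f 0 - y \<le> t * s"
    using s by (simp add: pos_divide_le_eq)
  moreover have "f (-t) \<le> f 0 - t * s"
    by (rule chord) (simp add: t_def)
  ultimately have "f (-t) \<le> y"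
    by simp
  moreover have "-t \<le> x"
    unfolding t_def by linarith
  ultimately obtain z where "f z = y"
    using IVT'[of f "-t" y x] below continuous_on_subset[OF cont] by blast
  then show ?thesis
    by blast
qed

context ppa_game
begin

lemma AE_law:
  assumes "a \<in> efforts G i" and "AE \<omega> in base G. P \<omega>"
  shows "AE \<omega> in law G i a. P \<omega>"
  using absolutely_continuous_AE[OF law_sets law_ac] assms by blast

lemma contract_integrable:
  assumes "\<xi> \<in> contracts G i" and "a \<in> efforts G i"
  shows "integrable (law G i a) (outcome G i)" "integrable (law G i a) \<xi>"
    "integrable (law G i a) (\<lambda>\<omega>. utility G i (\<xi> \<omega>))"
  using contracts_admissible[of i] assms unfolding admissible_def by blast+

text \<open>
  A negative shift is always below the upper gap, so admissibility applies. Admissibility speaks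
  of \<open>inv (utility G i)\<close>, which is a genuine preimage here because the range of the utility
  contains everything below an attained level.
\<close>

lemma contract_lowering_utility:
  assumes \<xi>: "\<xi> \<in> contracts G i" and d: "d > 0"
  obtains \<zeta> where "\<zeta> \<in> contracts G i"
    and "AE \<omega> in base G. utility G i (\<zeta> \<omega>) = utility G i (\<xi> \<omega>) - d"
proof -
  have "AE \<omega> in base G. ereal (utility G i (\<xi> \<omega>) + 0) \<le> (SUP x. ereal (utility G i x))"
    by (auto intro!: AE_I2 SUP_upper)
  then have "ereal 0 \<le> upper_gap G i \<xi>"
    unfolding upper_gap_def by (intro Sup_upper imageI) simp
  moreover have "ereal (- d) < ereal 0"
    using d by simp
  ultimately have "ereal (- d) < upper_gap G i \<xi>"
    by (rule less_le_trans[rotated])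
  then obtain \<zeta> where \<zeta>: "\<zeta> \<in> contracts G i"
    and inv: "AE \<omega> in base G. \<zeta> \<omega> = inv (utility G i) (utility G i (\<xi> \<omega>) + - d)"
    using contracts_admissible[of i] \<xi> unfolding admissible_def by blast
  have in_range: "utility G i (\<xi> \<omega>) - d \<in> range (utility G i)" for \<omega>
    using d range_downward_closed_concave_strict_mono[OF utility_strict_mono utility_concave
        differentiable_imp_continuous_on[OF utility_differentiable],
        of "utility G i (\<xi> \<omega>) - d" i "\<xi> \<omega>"]
    by simp
  from inv have "AE \<omega> in base G. utility G i (\<zeta> \<omega>) = utility G i (\<xi> \<omega>) - d"
    by eventually_elim (simp add: f_inv_into_f[OF in_range])
  with \<zeta> that show ?thesis
    by blast
qed

lemma agent_utility_shift:
  assumes \<xi>: "\<xi> \<in> contracts G i" and \<zeta>: "\<zeta> \<in> contracts G i" and a: "a \<in> efforts G i"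
    and shift: "AE \<omega> in base G. utility G i (\<zeta> \<omega>) = utility G i (\<xi> \<omega>) - d"
  shows "agent_utility G i (\<zeta>, a) = agent_utility G i (\<xi>, a) - d"
proof -
  interpret law: prob_space "law G i a"
    using law_prob[OF a] .
  have ints: "integrable (law G i a) (\<lambda>\<omega>. utility G i (\<xi> \<omega>))"
    "integrable (law G i a) (\<lambda>\<omega>. utility G i (\<zeta> \<omega>))"
    using contract_integrable(3)[OF \<xi> a] contract_integrable(3)[OF \<zeta> a] .
  have "(\<integral>\<omega>. utility G i (\<zeta> \<omega>) \<partial>law G i a) = (\<integral>\<omega>. utility G i (\<xi> \<omega>) - d \<partial>law G i a)"
    using ints AE_law[OF a shift] by (intro integral_cong_AE) auto
  also have "\<dots> = (\<integral>\<omega>. utility G i (\<xi> \<omega>) \<partial>law G i a) - d"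
    using ints by (simp add: law.prob_space)
  finally show ?thesis
    using ints by (simp add: agent_utility_def law.prob_space)
qed

text \<open>
  Utility left to the agent can be turned into profit. The shift has the same size for every
  effort, so the agent's optimal effort does not change.
\<close>

lemma cheaper_offer:
  assumes p: "p \<in> offers G i" and d: "d > 0"
  obtains q where "q \<in> offers G i" "agent_utility G i q = agent_utility G i p - d"
    "principal_profit G i p < principal_profit G i q"
proof -
  obtain \<xi> a where p_eq: "p = (\<xi>, a)" and \<xi>: "\<xi> \<in> contracts G i" and a: "a \<in> efforts G i"
    and ic: "is_arg_max (\<lambda>b. agent_utility G i (\<xi>, b)) (\<lambda>b. b \<in> efforts G i) a"
    using p unfolding offers_def by auto
  obtain \<zeta> where \<zeta>: "\<zeta> \<in> contracts G i"
    and shift: "AE \<omega> in base G. utility G i (\<zeta> \<omega>) = utility G i (\<xi> \<omega>) - d"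
    using contract_lowering_utility[OF \<xi> d] .
  note U = agent_utility_shift[OF \<xi> \<zeta> _ shift]
  have "(\<zeta>, a) \<in> offers G i"
    using \<zeta> a ic U unfolding offers_def by (auto simp: is_arg_max_def)
  moreover have "principal_profit G i (\<xi>, a) < principal_profit G i (\<zeta>, a)"
  proof -
    interpret law: prob_space "law G i a"
      using law_prob[OF a] .
    have "AE \<omega> in law G i a. utility G i (\<zeta> \<omega>) = utility G i (\<xi> \<omega>) - d"
      by (rule AE_law[OF a shift])
    then have "AE \<omega> in law G i a. outcome G i \<omega> - \<xi> \<omega> < outcome G i \<omega> - \<zeta> \<omega>"
    proof eventually_elim
      case (elim \<omega>)
      then have "utility G i (\<zeta> \<omega>) < utility G i (\<xi> \<omega>)"
        using d by simp
      then show ?case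
        using strict_mono_less[OF utility_strict_mono] by simp
    qed
    then show ?thesis
      unfolding principal_profit_def
      using contract_integrable[OF \<xi> a] contract_integrable[OF \<zeta> a]
      by (auto intro!: law.integral_less_AE_space simp: law.emeasure_space_1)
  qed
  ultimately show ?thesis
    using that U[OF a] unfolding p_eq by blast
qed

lemma optimal_offer_binds:
  assumes p: "p \<in> S G i R"
  shows "agent_utility G i p = R"
proof (rule ccontr)
  assume neq: "agent_utility G i p \<noteq> R"
  have p_offer: "p \<in> offers G i" and "R \<le> agent_utility G i p"
    and opt: "ereal (principal_profit G i p) = V G i R"
    using p unfolding S_def feasible_def by auto
  with neq have "agent_utility G i p - R > 0"
    by simp
  then obtain q where q: "q \<in> offers G i" "agent_utility G i q = R"
    and better: "principal_profit G i p < principal_profit G i q"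
    using cheaper_offer[OF p_offer] by (metis diff_diff_eq2 add_diff_cancel_left')
  have "ereal (principal_profit G i q) \<le> V G i R"
    unfolding V_def using q by (intro SUP_upper) (simp add: feasible_def)
  with better opt show False
    by (metis ereal_less_eq(3) not_le)
qed

text \<open>
  Losing earns nothing, and an offer that does not lose is feasible at the rival's level. The
  bias only scales the profit down, which can raise it at most to \<open>0\<close>.
\<close>

lemma payoff_le_max:
  assumes p: "p \<in> offers G i" and q: "q \<in> offers G (other i)"
    and R: "agent_utility G (other i) q = R" and v: "V G i R = ereal v"
  shows "payoff G i p q \<le> max 0 v"
proof (cases "agent_utility G i p < R")
  case True
  then show ?thesis
    using p q R by (simp add: payoff_def C_win_def C_tie_def C_lose_def)
next
  case False
  then have "ereal (principal_profit G i p) \<le> V G i R"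
    unfolding V_def using p by (intro SUP_upper) (simp add: feasible_def)
  then have profit: "principal_profit G i p \<le> v"
    using v by simp
  have b: "0 \<le> bias G i" "bias G i \<le> 1"
    using bias_range[of i] by auto
  have "bias G i * principal_profit G i p \<le> bias G i * max 0 v"
    using profit b by (intro mult_left_mono) auto
  also have "\<dots> \<le> max 0 v"
    using b by (intro mult_left_le_one_le) auto
  finally show ?thesis
    using False p q R profit by (auto simp: payoff_def C_win_def C_tie_def)
qed

text \<open>
  At a tie of individually optimal offers every deviation is dominated as soon as the tie payoff
  equals the bound of the previous lemma.
\<close>

lemma optimal_offers_nash:
  assumes p: "\<And>i. p i \<in> S G i R"
    and tie: "\<And>i. bias G i * principal_profit G i (p i) = max 0 (principal_profit G i (p i))"
  shows "nash_equilibrium G p"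
proof -
  have offer: "p i \<in> offers G i"
    and opt: "V G i R = ereal (principal_profit G i (p i))" for i
    using p[of i] unfolding S_def feasible_def by auto
  have binds: "agent_utility G i (p i) = R" for i
    using optimal_offer_binds[OF p] .
  have payoff: "payoff G i (p i) (p (other i)) = max 0 (principal_profit G i (p i))" for i
    using offer binds tie[of i] by (simp add: payoff_def C_win_def C_tie_def)
  have "p i \<in> best_responses G i (p (other i))" for i
    unfolding best_responses_def is_arg_max_linorder
    using offer payoff_le_max[OF _ offer binds opt] by (auto simp: payoff)
  with offer show ?thesis
    unfolding nash_equilibrium_def by blast
qed

lemma bias_other: "bias G (other i) = 1 - bias G i"
  using bias_sum by (cases i) auto

end

theorem proposition2p9:
  fixes G :: "'a ppa" and R\<^sub>0 :: real
  assumes "ppa_game G"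
    and "\<And>(R::real) i. ereal R \<le> min (R_bar G P1) (R_bar G P2) \<Longrightarrow> S G i R \<noteq> {}"
    and "ereal R\<^sub>0 \<le> min (R_bar G P1) (R_bar G P2)"
    and "(\<exists>i. bias G i = 1 \<and> V G i R\<^sub>0 > 0 \<and> 0 \<ge> V G (other i) R\<^sub>0) \<or>
         (\<exists>i. bias G i = 1 \<and> V G i R\<^sub>0 \<ge> 0 \<and> 0 > V G (other i) R\<^sub>0) \<or>
         (V G P1 R\<^sub>0 = 0 \<and> V G P2 R\<^sub>0 = 0)"
  shows "\<exists>p. nash_equilibrium G p \<and> (\<forall>i. V G i R\<^sub>0 \<ge> 0 \<longrightarrow> p i \<in> S G i R\<^sub>0)"
proof -
  interpret ppa_game G
    by (rule assms(1))
  define p where "p i = (SOME q. q \<in> S G i R\<^sub>0)" for i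
  have p: "p i \<in> S G i R\<^sub>0" for i
    unfolding p_def using assms(2)[OF assms(3), of i] by (simp add: some_in_eq)
  have opt: "V G i R\<^sub>0 = ereal (principal_profit G i (p i))" for i
    using p[of i] unfolding S_def by simp
  have "bias G i * principal_profit G i (p i) = max 0 (principal_profit G i (p i))" for i
  proof -
    have "(\<exists>j. bias G j = 1 \<and> V G j R\<^sub>0 \<ge> 0 \<and> V G (other j) R\<^sub>0 \<le> 0)
        \<or> (V G P1 R\<^sub>0 = 0 \<and> V G P2 R\<^sub>0 = 0)"
      using assms(4) by (meson less_imp_le)
    then show ?thesis
    proof (elim disjE exE conjE)
      fix j assume j: "bias G j = 1" "V G j R\<^sub>0 \<ge> 0" "V G (other j) R\<^sub>0 \<le> 0"
      have "i = j \<or> i = other j"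
        by (cases i; cases j) auto
      with j show ?thesis
        by (auto simp: opt bias_other)
    next
      assume "V G P1 R\<^sub>0 = 0" "V G P2 R\<^sub>0 = 0"
      then show ?thesis
        by (cases i) (auto simp: opt)
    qed
  qed
  then have "nash_equilibrium G p"
    using p by (rule optimal_offers_nash[rotated])
  with p show ?thesis
    by blast
qed

end
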